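(* Let $J\in C(\mathbb{R})$ satisfy $J\ge 0$, $\int_{\mathbb{R}}J=1$, and suppose there exist $a<0<b$ with $J(a)>0$ and $J(b)>0$. Let $\mathcal{M}[u]=J\star u-u$ and let $c\in L^\infty(\mathbb{R})$. If $u\in L^\infty(\mathbb{R})$ satisfies $u\le 0$ a.e. and $\mathcal{M}[u]+c(x)u\ge 0$ a.e. in $\mathbb{R}$, then either $\operatorname{ess\,sup}_K u<0$ for all compact $K\subset\mathbb{R}$, or $u=0$ a.e. in $\mathbb{R}$.
   Context: Convolution: $(J\star u)(x)=\int_{\mathbb{R}}J(x-y)u(y)\,dy$. *)

theory Defs
  imports "HOL-Probability.Essential_Supremum"
begin

text \<open>Elements of \<open>L\<^sup>\<infinity>(\<real>)\<close> are represented by real-valued functions, not by equivalence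
  classes.\<close>

definition L_infty :: "(real \<Rightarrow> real) set" where
  "L_infty = {f \<in> borel_measurable lebesgue. \<exists>C. AE x in lebesgue. \<bar>f x\<bar> \<le> C}"

text \<open>The Bochner integral is \<open>0\<close> by convention if the integrand is not integrable. For
  integrable \<open>J\<close> and \<open>u\<close> in \<open>L_infty\<close> the integrand below is integrable for every \<open>x\<close>.\<close>

definition convolution :: "(real \<Rightarrow> real) \<Rightarrow> (real \<Rightarrow> real) \<Rightarrow> real \<Rightarrow> real"  (infixl \<open>\<star>\<close> 70) where
  "(J \<star> u) x = (LINT y|lebesgue. J (x - y) * u y)"

definition nonlocal_op :: "(real \<Rightarrow> real) \<Rightarrow> (real \<Rightarrow> real) \<Rightarrow> real \<Rightarrow> real" where
  "nonlocal_op J u x = (J \<star> u) x - u x"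

text \<open>The essential supremum is extended-real-valued; over a Lebesgue null set it is \<open>-\<infinity>\<close>.\<close>

definition ess_sup_on :: "real set \<Rightarrow> (real \<Rightarrow> real) \<Rightarrow> ereal" where
  "ess_sup_on K u = esssup (restrict_space lebesgue K) (\<lambda>x. ereal (u x))"

end

theory Submission
  imports Defs
begin

text \<open>Put \<open>v = - u\<close> and \<open>W = J \<star> v\<close>. The inequality says \<open>W \<le> (1 - c) v\<close> a.e., so \<open>v\<close> is
  bounded below by a multiple of \<open>W\<close>, and \<open>W\<close> is lower semicontinuous by Fatou's lemma. If
  \<open>W > 0\<close> everywhere, compactness bounds \<open>v\<close> away from \<open>0\<close> on compact sets. If \<open>W x = 0\<close>, then
  \<open>v\<close> vanishes a.e. on the open set \<open>{y. J (x - y) > 0}\<close>, hence so does \<open>W\<close>, everywhere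
  on it by semicontinuity. So the zero set of \<open>W\<close> is stable under all translations by elements of
  two intervals, one on each side of the origin; these translations generate \<open>\<real>\<close>, so \<open>W\<close> and
  therefore \<open>v\<close> vanish identically.\<close>

text \<open>Fatou's lemma along an arbitrary sequence tending to \<open>x\<close> gives the
  sequential version; first countability turns it into a statement about neighbourhoods.\<close>

lemma nn_integral_lower_semicontinuous:
  fixes f :: "'a::first_countable_topology \<Rightarrow> 'b \<Rightarrow> ennreal"
  assumes meas: "\<And>x. f x \<in> borel_measurable M"
    and cont: "\<And>x y. y \<in> space M \<Longrightarrow> ((\<lambda>z. f z y) \<longlongrightarrow> f x y) (nhds x)"
    and less: "\<alpha> < (\<integral>\<^sup>+ y. f x y \<partial>M)"
  shows "\<forall>\<^sub>F z in nhds x. \<alpha> < (\<integral>\<^sup>+ y. f z y \<partial>M)"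
proof -
  have "\<forall>\<^sub>F n in sequentially. \<alpha> < (\<integral>\<^sup>+ y. f (X n) y \<partial>M)" if X: "X \<longlonglongrightarrow> x" for X
  proof -
    have "(\<integral>\<^sup>+ y. f x y \<partial>M) = (\<integral>\<^sup>+ y. liminf (\<lambda>n. f (X n) y) \<partial>M)"
    proof (rule nn_integral_cong)
      fix y assume "y \<in> space M"
      then have "(\<lambda>n. f (X n) y) \<longlonglongrightarrow> f x y"
        using filterlim_compose[OF cont X] by blast
      then show "f x y = liminf (\<lambda>n. f (X n) y)"
        by (simp add: lim_imp_Liminf)
    qed
    also have "\<dots> \<le> liminf (\<lambda>n. \<integral>\<^sup>+ y. f (X n) y \<partial>M)"
      by (intro nn_integral_liminf meas)
    finally have "\<alpha> < liminf (\<lambda>n. \<integral>\<^sup>+ y. f (X n) y \<partial>M)"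
      using less by order
    then show ?thesis
      by (rule less_LiminfD)
  qed
  then have "\<forall>\<^sub>F z in inf (nhds x) (principal UNIV). \<alpha> < (\<integral>\<^sup>+ y. f z y \<partial>M)"
    by (intro sequentially_imp_eventually_nhds_within) blast
  then show ?thesis
    by simp
qed

lemma add_of_nat_mult_mem:
  fixes s :: "'a::semiring_1"
  assumes "x \<in> Z" and "\<And>x. x \<in> Z \<Longrightarrow> x + s \<in> Z"
  shows "x + of_nat k * s \<in> Z"
proof (induction k)
  case (Suc k)
  have "x + of_nat (Suc k) * s = x + of_nat k * s + s"
    by (simp add: algebra_simps)
  with assms(2)[OF Suc] show ?case
    by (simp only:)
qed (simp add: assms(1))

text \<open>Some step near \<open>p\<close> is commensurable with \<open>q\<close>, so suitably many
  steps of both kinds cancel. Perturbing the former steps slightly leaves any prescribed small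
  displacement, and small displacements add up to arbitrary ones.\<close>

lemma translation_stable_eq_UNIV:
  fixes Z :: "real set"
  assumes "p > 0" and "q < 0" and "r > 0" and "x0 \<in> Z"
    and step_p: "\<And>x s. x \<in> Z \<Longrightarrow> \<bar>s - p\<bar> < r \<Longrightarrow> x + s \<in> Z"
    and step_q: "\<And>x. x \<in> Z \<Longrightarrow> x + q \<in> Z"
  shows "Z = UNIV"
proof -
  obtain t where t: "t \<in> \<rat>" "p / - q < t" "t < (p + r) / - q"
  proof -
    have "p / - q < (p + r) / - q"
      using assms(2,3) by (intro divide_strict_right_mono) auto
    from Rats_dense_in_real[OF this] show ?thesis
      using that by blast
  qed
  have "t > 0"
    using t(2) assms(1,2) by (smt (verit) divide_pos_pos)
  then obtain m n :: nat where mn: "m \<noteq> 0" "t = real n / real m"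
    using t(1) by (metis Rats_abs_nat_div_natE abs_of_pos)
  \<comment> \<open>The distance from \<open>t * (- q)\<close> to the nearer endpoint of the
    interval of radius \<open>r\<close> around \<open>p\<close>.\<close>
  define \<delta> where "\<delta> = min (r - (t * (- q) - p)) (r + (t * (- q) - p))"
  have "p < t * (- q)" "t * (- q) < p + r"
    using t(2,3) assms(2) by (auto simp: field_simps)
  then have \<delta>: "\<delta> > 0"
    using assms(3) by (auto simp: \<delta>_def)
  have small: "x + d \<in> Z" if "x \<in> Z" "\<bar>d\<bar> < \<delta>" for x d
  proof -
    \<comment> \<open>As \<open>t = n / m\<close>, \<open>m\<close> steps of length
      \<open>t * (- q)\<close> undo \<open>n\<close> steps of \<open>q\<close>; the correction
      \<open>d / m\<close> in each of the \<open>m\<close> steps leaves exactly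
      \<open>d\<close>.\<close>
    define s where "s = t * (- q) + d / real m"
    have "\<bar>d / real m\<bar> \<le> \<bar>d\<bar>"
      using mn(1) by (simp add: field_simps mult_le_cancel_left1)
    then have "\<bar>s - p\<bar> < r"
      using that(2) unfolding s_def \<delta>_def min_less_iff_conj by linarith
    then have "x + real m * s + real n * q \<in> Z"
      by (intro add_of_nat_mult_mem step_p step_q that(1))
    moreover have "real m * s + real n * q = d"
      using mn by (simp add: s_def field_simps)
    ultimately show ?thesis
      by (simp add: add.assoc)
  qed
  have iter_small: "x0 + real k * d \<in> Z" if "\<bar>d\<bar> < \<delta>" for d k
    by (intro add_of_nat_mult_mem small assms(4) that)
  have "x \<in> Z" for x
  proof -
    obtain k :: nat where k: "\<bar>x - x0\<bar> / \<delta> < real k"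
      using reals_Archimedean2 by blast
    then have "real k > 0"
      using \<delta> by (smt (verit) divide_nonneg_pos)
    then have "\<bar>(x - x0) / real k\<bar> < \<delta>"
      using k \<delta> by (simp add: field_simps)
    then show ?thesis
      using iter_small[of "(x - x0) / real k" k] \<open>real k > 0\<close> by simp
  qed
  then show ?thesis
    by blast
qed

lemma AE_lebesgue_open_imp:
  fixes S :: "'a::euclidean_space set"
  assumes "open S" and "AE x in lebesgue. x \<notin> S"
  shows "S = {}"
proof -
  have "S \<in> null_sets lebesgue"
    using assms by (subst AE_iff_null_sets) auto
  then show ?thesis
    using assms(1) open_not_negligible by (auto simp: negligible_iff_null_sets)
qed

lemma integrable_lebesgue_reflect_translate:
  fixes J :: "real \<Rightarrow> real"
  assumes "J \<in> borel_measurable borel" and "integrable lebesgue J"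
  shows "integrable lebesgue (\<lambda>y. J (x - y))"
proof -
  have "integrable lborel J"
    using assms by (simp add: integrable_completion)
  from lborel_integrable_real_affine[OF this, of "- 1" x]
  show ?thesis
    using assms(1) by (simp add: integrable_completion)
qed

text \<open>A finite subcover of \<open>K\<close> yields one \<epsilon> for all of \<open>K\<close>.
  The predicate \<open>P\<close> separates what holds at every point (\<open>loc\<close>) from what
  holds only almost everywhere (\<open>bound\<close>).\<close>

lemma ess_sup_on_less_zero:
  assumes "compact K" and u: "u \<in> borel_measurable lebesgue"
    and loc: "\<And>x. \<exists>\<epsilon>>0. \<forall>\<^sub>F z in nhds x. P \<epsilon> z"
    and bound: "\<And>\<epsilon>. \<epsilon> > 0 \<Longrightarrow> AE z in lebesgue. P \<epsilon> z \<longrightarrow> u z \<le> - \<epsilon>"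
  shows "ess_sup_on K u < 0"
proof -
  obtain e where e: "\<And>x. e x > 0" and ev: "\<And>x. \<forall>\<^sub>F z in nhds x. P (e x) z"
    using loc by metis
  obtain S where S: "\<And>x. open (S x)" "\<And>x. x \<in> S x" and P: "\<And>x z. z \<in> S x \<Longrightarrow> P (e x) z"
    using ev unfolding eventually_nhds by metis
  have "K \<subseteq> (\<Union>x\<in>K. S x)"
    using S(2) by blast
  with \<open>compact K\<close> obtain F where F: "F \<subseteq> K" "finite F" "K \<subseteq> (\<Union>x\<in>F. S x)"
    by (rule compactE_image[OF _ S(1)])
  \<comment> \<open>Inserting 1 keeps \<open>Min\<close> meaningful when \<open>F\<close> is
    empty.\<close>
  define \<epsilon> where "\<epsilon> = Min (insert 1 (e ` F))"
  have le: "\<epsilon> \<le> e x" if "x \<in> F" for x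
    using F(2) e that by (auto simp: \<epsilon>_def)
  have \<epsilon>: "\<epsilon> > 0"
    using F(2) e by (auto simp: \<epsilon>_def)
  \<comment> \<open>The exceptional null set depends on \<open>e x\<close>, but only finitely many
    of them occur.\<close>
  have "AE z in lebesgue. \<forall>x\<in>F. P (e x) z \<longrightarrow> u z \<le> - e x"
    using F(2) e bound by (auto intro: AE_finite_allI)
  then have "AE z in lebesgue. z \<in> K \<longrightarrow> ereal (u z) \<le> ereal (- \<epsilon>)"
    by eventually_elim (use F(3) P le in fastforce)
  moreover have "K \<in> sets lebesgue"
    using \<open>compact K\<close> by (simp add: compact_imp_closed)
  ultimately have "AE z in restrict_space lebesgue K. ereal (u z) \<le> ereal (- \<epsilon>)"
    by (subst AE_restrict_space_iff) auto
  moreover have "(\<lambda>z. ereal (u z)) \<in> borel_measurable (restrict_space lebesgue K)"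
    using u by (intro measurable_restrict_space1 borel_measurable_ereal)
  ultimately have "ess_sup_on K u \<le> ereal (- \<epsilon>)"
    unfolding ess_sup_on_def by (intro esssup_I)
  also have "\<dots> < 0"
    using \<epsilon> by simp
  finally show ?thesis .
qed

theorem theorem1p4:
  fixes J c u :: "real \<Rightarrow> real" and a b :: real
  assumes "continuous_on UNIV J"
    and "\<And>x. J x \<ge> 0"
    and "integrable lebesgue J" and "(LINT x|lebesgue. J x) = 1"
    and "a < 0" and "0 < b" and "J a > 0" and "J b > 0"
    and "c \<in> L_infty"
    and "u \<in> L_infty"
    and "AE x in lebesgue. u x \<le> 0"
    and "AE x in lebesgue. nonlocal_op J u x + c x * u x \<ge> 0"
  shows "(\<forall>K. compact K \<longrightarrow> ess_sup_on K u < 0) \<or> (AE x in lebesgue. u x = 0)"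
proof -
  have J_isCont: "isCont J x" for x
    using assms(1) by (simp add: continuous_on_eq_continuous_at)
  have J_tendsto: "((\<lambda>z. J (z - y)) \<longlongrightarrow> J (x - y)) (nhds x)"
    and J_tendsto': "((\<lambda>z. J (y - z)) \<longlongrightarrow> J (y - x)) (nhds x)" for x y
    by (intro isCont_tendsto_compose[OF J_isCont] tendsto_diff tendsto_const filterlim_ident)+
  have J_borel: "J \<in> borel_measurable borel"
    using assms(1) by (rule borel_measurable_continuous_onI)
  have J_int: "integrable lebesgue (\<lambda>y. J (x - y))" for x
    by (rule integrable_lebesgue_reflect_translate[OF J_borel assms(3)])
  have J_shift [measurable]: "(\<lambda>y. J (x - y)) \<in> borel_measurable lebesgue" for x
    using J_int by (rule borel_measurable_integrable)
  obtain Cu where u [measurable]: "u \<in> borel_measurable lebesgue"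
    and Cu: "AE x in lebesgue. \<bar>u x\<bar> \<le> Cu"
    using assms(10) by (auto simp: L_infty_def)
  obtain Cc where Cc: "AE x in lebesgue. \<bar>c x\<bar> \<le> Cc"
    using assms(9) by (auto simp: L_infty_def)
  \<comment> \<open>A positive upper bound for \<open>1 - c\<close> almost everywhere.\<close>
  define C where "C = 1 + \<bar>Cc\<bar>"
  have C: "C > 0"
    by (simp add: C_def)

  \<comment> \<open>As an \<open>ennreal\<close> integral, \<open>W\<close> is open to Fatou's lemma
    and to the criterion for vanishing integrals. Truncating negative values at 0 is harmless
    because \<open>u\<close> is nonpositive almost everywhere.\<close>
  define W where "W x = (\<integral>\<^sup>+ y. ennreal (J (x - y) * - u y) \<partial>lebesgue)" for x
  have W_conv: "W x = ennreal (- (J \<star> u) x)" for x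
  proof -
    have "integrable lebesgue (\<lambda>y. J (x - y) * - u y)"
    proof (rule Bochner_Integration.integrable_bound)
      show "integrable lebesgue (\<lambda>y. Cu * J (x - y))"
        using J_int by simp
      show "AE y in lebesgue. norm (J (x - y) * - u y) \<le> norm (Cu * J (x - y))"
        using Cu
      proof eventually_elim
        case (elim y)
        then have "\<bar>J (x - y)\<bar> * \<bar>u y\<bar> \<le> \<bar>J (x - y)\<bar> * \<bar>Cu\<bar>"
          by (intro mult_left_mono) auto
        then show ?case
          by (simp add: abs_mult mult.commute)
      qed
    qed measurable
    moreover have "AE y in lebesgue. 0 \<le> J (x - y) * - u y"
      using assms(11) by eventually_elim (use assms(2) in \<open>simp add: mult_nonneg_nonpos\<close>)
    ultimately have "W x = ennreal (LINT y|lebesgue. J (x - y) * - u y)"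
      unfolding W_def by (rule nn_integral_eq_integral)
    then show ?thesis
      by (simp add: convolution_def)
  qed
  have W_le: "AE x in lebesgue. W x \<le> ennreal (C * - u x)"
    using assms(11,12) Cc
  proof eventually_elim
    case (elim x)
    have "- (J \<star> u) x \<le> (1 - c x) * - u x"
      using elim(2) by (simp add: nonlocal_op_def algebra_simps)
    also have "\<dots> \<le> C * - u x"
      using elim(1,3) by (intro mult_right_mono) (auto simp: C_def)
    finally show ?case
      unfolding W_conv by (rule ennreal_leI)
  qed
  have W_lsc: "\<forall>\<^sub>F z in nhds x. \<alpha> < W z" if "\<alpha> < W x" for \<alpha> x
    using that unfolding W_def
    by (intro nn_integral_lower_semicontinuous tendsto_ennrealI tendsto_mult J_tendsto tendsto_const)
      (auto simp: measurable_compose)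
  have W_zero_AE: "AE y in lebesgue. J (x - y) > 0 \<longrightarrow> u y = 0" if "W x = 0" for x
  proof -
    have "AE y in lebesgue. ennreal (J (x - y) * - u y) = 0"
      using that unfolding W_def by (subst (asm) nn_integral_0_iff_AE) auto
    with assms(11) show ?thesis
      by eventually_elim (auto simp: ennreal_eq_0_iff zero_le_mult_iff)
  qed
  \<comment> \<open>Otherwise \<open>W\<close> and \<open>J (x - y)\<close> would both be positive
    for \<open>y\<close> in an open set around \<open>z\<close>. There \<open>u\<close> vanishes
    almost everywhere, so \<open>W_le\<close> forces \<open>W\<close> to vanish too, although a
    nonempty open set is not null.\<close>
  have W_zero_step: "W z = 0" if x: "W x = 0" and z: "J (x - z) > 0" for x z
  proof (rule ccontr)
    assume "W z \<noteq> 0"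
    then have "\<forall>\<^sub>F y in nhds z. 0 < W y"
      by (intro W_lsc) (simp add: zero_less_iff_neq_zero)
    moreover have "\<forall>\<^sub>F y in nhds z. 0 < J (x - y)"
      using J_tendsto' z by (rule order_tendstoD)
    ultimately have "\<forall>\<^sub>F y in nhds z. 0 < W y \<and> 0 < J (x - y)"
      by (rule eventually_conj)
    then obtain S where S: "open S" "z \<in> S" "\<And>y. y \<in> S \<Longrightarrow> 0 < W y \<and> 0 < J (x - y)"
      unfolding eventually_nhds by blast
    have "AE y in lebesgue. y \<notin> S"
      using W_zero_AE[OF x] W_le by eventually_elim (use S(3) in force)
    then show False
      using AE_lebesgue_open_imp S(1,2) by blast
  qed

  show ?thesis
  proof (cases "\<exists>x0. W x0 = 0")
    case False
    have "ess_sup_on K u < 0" if "compact K" for K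
      using that u
    proof (rule ess_sup_on_less_zero)
      fix x
      \<comment> \<open>Half the value of \<open>W x\<close>, to have strict room below it; \<eta>
        divided by \<open>C\<close> is then the local bound.\<close>
      define \<eta> where "\<eta> = - (J \<star> u) x / 2"
      have "0 < W x"
        using False by (simp add: zero_less_iff_neq_zero)
      then have \<eta>: "\<eta> > 0" "ennreal \<eta> < W x"
        by (auto simp: W_conv \<eta>_def ennreal_less_iff)
      then have "\<forall>\<^sub>F z in nhds x. ennreal (C * (\<eta> / C)) < W z"
        using W_lsc C by simp
      then show "\<exists>\<epsilon>>0. \<forall>\<^sub>F z in nhds x. ennreal (C * \<epsilon>) < W z"
        using \<eta>(1) C by (meson divide_pos_pos)
    next
      fix \<epsilon> :: real assume "\<epsilon> > 0"
      show "AE z in lebesgue. ennreal (C * \<epsilon>) < W z \<longrightarrow> u z \<le> - \<epsilon>"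
        using W_le
      proof eventually_elim
        case (elim z)
        show ?case
        proof
          assume "ennreal (C * \<epsilon>) < W z"
          with elim have "ennreal (C * \<epsilon>) < ennreal (C * - u z)"
            by order
          then have "C * \<epsilon> < C * - u z"
            using C \<open>\<epsilon> > 0\<close> by (subst (asm) ennreal_less_iff) auto
          then show "u z \<le> - \<epsilon>"
            using C by (subst (asm) mult_less_cancel_left_pos) auto
        qed
      qed
    qed
    then show ?thesis
      by blast
  next
    case True
    have J_pos_near: "\<exists>r>0. \<forall>s. \<bar>s - t\<bar> < r \<longrightarrow> J s > 0" if "J t > 0" for t
    proof -
      have "\<forall>\<^sub>F s in nhds t. J s > 0"
        using J_tendsto[of 0 t] that by (intro order_tendstoD) auto
      then show ?thesis
        by (auto simp: eventually_nhds_metric dist_real_def)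
    qed
    obtain r where r: "r > 0" "\<And>s. \<bar>s - a\<bar> < r \<Longrightarrow> J s > 0"
      using J_pos_near assms(7) by blast
    obtain x0 where "W x0 = 0"
      using True by blast
    \<comment> \<open>Moving from \<open>x\<close> to \<open>x + s\<close> requires
      \<open>J (- s) > 0\<close>, so the signs flip: steps near \<open>- a\<close> go right, the
      step \<open>- b\<close> goes left.\<close>
    have "{x. W x = 0} = UNIV"
    proof (rule translation_stable_eq_UNIV[of "- a" "- b" r x0])
      show "x + s \<in> {x. W x = 0}" if "x \<in> {x. W x = 0}" "\<bar>s - - a\<bar> < r" for x s
      proof -
        have "J (- s) > 0"
          using that(2) by (intro r(2)) auto
        then show ?thesis
          using W_zero_step[of x "x + s"] that(1) by simp
      qed
      show "x + - b \<in> {x. W x = 0}" if "x \<in> {x. W x = 0}" for x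
        using W_zero_step[of x "x + - b"] that assms(8) by simp
    qed (use assms(5,6) r(1) \<open>W x0 = 0\<close> in auto)
    then have "W x = 0" for x
      by blast
    \<comment> \<open>The null set in \<open>W_zero_AE\<close> depends on \<open>x\<close>, so
      \<open>x\<close> is restricted to a countable set; by density, every \<open>y\<close> has a
      rational \<open>x\<close> with \<open>x - y\<close> between \<open>a\<close> and
      \<open>a + r\<close>.\<close>
    then have "AE y in lebesgue. \<forall>x\<in>\<rat>. J (x - y) > 0 \<longrightarrow> u y = 0"
      by (intro AE_ball_countable' countable_rat W_zero_AE)
    then have "AE y in lebesgue. u y = 0"
    proof eventually_elim
      case (elim y)
      obtain x where "x \<in> \<rat>" "y + a < x" "x < y + a + r"
        using Rats_dense_in_real[of "y + a" "y + a + r"] r(1) by auto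
      moreover from this have "J (x - y) > 0"
        by (intro r(2)) auto
      ultimately show ?case
        using elim by blast
    qed
    then show ?thesis
      by blast
  qed
qed

end
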